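(* For every odd integer $n\ge 3$, $\gamma_I(C_2 \square C_n) = n+1$.
   Context: For an integer $k\ge 2$, $C_k$ denotes the directed cycle with vertex set $\{1,2,\dots,k\}$ and arcs $i\rightarrow i+1$ (indices taken modulo $k$); in particular $C_2$ has arcs $1\rightarrow 2$ and $2\rightarrow 1$. For digraphs $D_1=(V_1,A_1)$ and $D_2=(V_2,A_2)$, the cartesian product $D_1\square D_2$ is the digraph with vertex set $V_1\times V_2$ in which $(x_1,x_2)\rightarrow(y_1,y_2)$ is an arc if and only if either ($x_1=y_1$ and $x_2\rightarrow y_2$ in $D_2$) or ($x_1\rightarrow y_1$ in $D_1$ and $x_2=y_2$). An Italian dominating function on a digraph $D$ is a function $f:V(D)\to\{0,1,2\}$ such that every vertex $v$ with $f(v)=0$ has at least two in-neighbors $u$ with $f(u)=1$ or at least one in-neighbor $w$ with $f(w)=2$ (an in-neighbor of $v$ is a vertex $u$ with $u\rightarrow v$). Its weight is $\sum_{u\in V(D)} f(u)$, and the Italian domination number $\gamma_I(D)$ is the minimum weight of an Italian dominating function on $D$. *)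

theory Defs
  imports "Graph_Theory.Graph_Theory"
begin

text \<open>The successor of \<open>i\<close> in \<open>{1..k}\<close> modulo \<open>k\<close> is \<open>i mod k + 1\<close>; in particular \<open>k\<close> is mapped to \<open>1\<close>.\<close>

definition dicycle :: "nat \<Rightarrow> nat pair_pre_digraph" where
  "dicycle k = \<lparr> pverts = {1..k}, parcs = {(i, i mod k + 1) | i. i \<in> {1..k}} \<rparr>"

definition cart_prod :: "'a pair_pre_digraph \<Rightarrow> 'b pair_pre_digraph \<Rightarrow> ('a \<times> 'b) pair_pre_digraph"
    (infixr \<open>\<box>\<close> 70) where
  "D1 \<box> D2 = \<lparr> pverts = pverts D1 \<times> pverts D2,
     parcs = {((x1, x2), (y1, y2)) | x1 x2 y1 y2.
       (x1, x2) \<in> pverts D1 \<times> pverts D2 \<and> (y1, y2) \<in> pverts D1 \<times> pverts D2 \<and>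
       ((x1 = y1 \<and> (x2, y2) \<in> parcs D2) \<or> ((x1, y1) \<in> parcs D1 \<and> x2 = y2))} \<rparr>"

definition in_neighbors :: "'a pair_pre_digraph \<Rightarrow> 'a \<Rightarrow> 'a set" where
  "in_neighbors D v = {u \<in> pverts D. (u, v) \<in> parcs D}"

text \<open>Functions on the vertex set are total functions whose values outside the vertex set are
  irrelevant. The definitions below are meant for finite digraphs.\<close>

definition italian_dominating :: "'a pair_pre_digraph \<Rightarrow> ('a \<Rightarrow> nat) \<Rightarrow> bool" where
  "italian_dominating D f \<longleftrightarrow>
     (\<forall>v \<in> pverts D. f v \<in> {0, 1, 2}) \<and>
     (\<forall>v \<in> pverts D. f v = 0 \<longrightarrow>
        card {u \<in> in_neighbors D v. f u = 1} \<ge> 2 \<or> (\<exists>w \<in> in_neighbors D v. f w = 2))"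

definition weight :: "'a pair_pre_digraph \<Rightarrow> ('a \<Rightarrow> nat) \<Rightarrow> nat" where
  "weight D f = (\<Sum>u \<in> pverts D. f u)"

definition italian_domination_number :: "'a pair_pre_digraph \<Rightarrow> nat" (\<open>\<gamma>\<^sub>I\<close>) where
  "\<gamma>\<^sub>I D = (LEAST w. \<exists>f. italian_dominating D f \<and> weight D f = w)"

lemma italian_domination_number_attained:
  "\<exists>f. italian_dominating D f \<and> weight D f = \<gamma>\<^sub>I D"
proof -
  have "italian_dominating D (\<lambda>_. 1)"
    by (simp add: italian_dominating_def)
  then have "\<exists>f. italian_dominating D f \<and> weight D f = weight D (\<lambda>_. 1)"
    by blast
  then show ?thesis
    unfolding italian_domination_number_def by (rule LeastI)
qed

lemma italian_domination_number_le:
  "italian_dominating D f \<Longrightarrow> \<gamma>\<^sub>I D \<le> weight D f"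
  unfolding italian_domination_number_def by (rule Least_le) blast

lemma pair_digraph_dicycle:
  assumes "k \<ge> 2"
  shows "pair_digraph (dicycle k)"
proof
  fix e assume "e \<in> parcs (dicycle k)"
  then obtain i where i: "e = (i, i mod k + 1)" "1 \<le> i" "i \<le> k"
    by (auto simp: dicycle_def)
  have "Suc (i mod k) \<le> k" using assms by (simp add: Suc_le_eq)
  then show "fst e \<in> pverts (dicycle k)" "snd e \<in> pverts (dicycle k)"
    using i by (auto simp: dicycle_def)
  show "fst e \<noteq> snd e"
    using i assms by (cases "i = k") auto
next
  show "finite (pverts (dicycle k))" by (simp add: dicycle_def)
  have "parcs (dicycle k) = (\<lambda>i. (i, i mod k + 1)) ` {1..k}"
    by (auto simp: dicycle_def)
  then show "finite (parcs (dicycle k))" by simp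
qed

lemma pair_digraph_cart_prod:
  assumes "pair_digraph D1" "pair_digraph D2"
  shows "pair_digraph (D1 \<box> D2)"
proof -
  interpret D1: pair_digraph D1 by fact
  interpret D2: pair_digraph D2 by fact
  show ?thesis
  proof
    fix e assume "e \<in> parcs (D1 \<box> D2)"
    then show "fst e \<in> pverts (D1 \<box> D2)" "snd e \<in> pverts (D1 \<box> D2)" "fst e \<noteq> snd e"
      using D1.pair_no_loops D2.pair_no_loops by (auto simp: cart_prod_def)
  next
    show fin: "finite (pverts (D1 \<box> D2))"
      by (simp add: cart_prod_def D1.pair_finite_verts D2.pair_finite_verts)
    have "parcs (D1 \<box> D2) \<subseteq> pverts (D1 \<box> D2) \<times> pverts (D1 \<box> D2)"
      by (auto simp: cart_prod_def)
    then show "finite (parcs (D1 \<box> D2))"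
      using fin by (meson finite_SigmaI finite_subset)
  qed
qed

end

theory Submission
  imports Defs
begin

text \<open>
  A vertex of value \<open>0\<close> is dominated iff the values of its in-neighbours add up to at least \<open>2\<close>.
  Every vertex of \<open>C\<^sub>2 \<box> C\<^sub>n\<close> has one in-neighbour in its own column and one in its own row, and it
  follows that two consecutive columns have total weight at least \<open>2\<close>. Summing around the cycle
  bounds the weight below by \<open>n\<close>. If the weight were at most \<open>n\<close>, any two consecutive columns would
  have total weight exactly \<open>2\<close>. For odd \<open>n\<close> this forces weight \<open>1\<close> on every column, and the value
  \<open>1\<close> then alternates between the two rows, which is again impossible around an odd cycle. A column
  \<open>(1, 1)\<close> followed by alternating columns attains \<open>n + 1\<close>.
\<close>

lemma two_le_sum_iff:
  fixes f :: "'a \<Rightarrow> nat"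
  assumes "finite A" and le_2: "\<And>x. x \<in> A \<Longrightarrow> f x \<le> 2"
  shows "2 \<le> sum f A \<longleftrightarrow> 2 \<le> card {x \<in> A. f x = 1} \<or> (\<exists>x \<in> A. f x = 2)"
proof (cases "\<exists>x \<in> A. f x = 2")
  case True
  then show ?thesis
    using member_le_sum[of _ A f] \<open>finite A\<close> by fastforce
next
  case False
  then have "f x = 0" if "x \<in> A" "f x \<noteq> 1" for x
    using le_2[of x] that by (cases "f x = 2") auto
  then have "sum f A = sum f {x \<in> A. f x = 1}"
    using \<open>finite A\<close> by (intro sum.mono_neutral_right) auto
  then show ?thesis
    using False by simp
qed

lemma italian_dominating_iff_sum:
  assumes "finite (pverts D)"
  shows "italian_dominating D f \<longleftrightarrow>
    (\<forall>v \<in> pverts D. f v \<le> 2) \<and>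
    (\<forall>v \<in> pverts D. f v = 0 \<longrightarrow> 2 \<le> (\<Sum>u \<in> in_neighbors D v. f u))"
proof (cases "\<forall>v \<in> pverts D. f v \<le> 2")
  case True
  have "2 \<le> (\<Sum>u \<in> in_neighbors D v. f u) \<longleftrightarrow>
      2 \<le> card {u \<in> in_neighbors D v. f u = 1} \<or> (\<exists>w \<in> in_neighbors D v. f w = 2)" for v
    using assms True by (intro two_le_sum_iff) (auto simp: in_neighbors_def)
  moreover have "\<forall>v \<in> pverts D. f v \<in> {0, 1, 2}"
    using True by force
  ultimately show ?thesis
    using True by (simp add: italian_dominating_def)
next
  case False
  then show ?thesis
    by (force simp: italian_dominating_def)
qed

lemma pverts_cart_prod: "pverts (D1 \<box> D2) = pverts D1 \<times> pverts D2"
  by (simp add: cart_prod_def)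

lemma weight_cart_prod:
  "weight (D1 \<box> D2) f = (\<Sum>x \<in> pverts D1. \<Sum>y \<in> pverts D2. f (x, y))"
  by (simp add: weight_def pverts_cart_prod sum.cartesian_product)

lemma in_neighbors_cart_prod:
  assumes "x \<in> pverts D1" "y \<in> pverts D2"
  shows "in_neighbors (D1 \<box> D2) (x, y) =
    in_neighbors D1 x \<times> {y} \<union> {x} \<times> in_neighbors D2 y"
  using assms by (auto simp: in_neighbors_def cart_prod_def)

lemma sum_in_neighbors_cart_prod:
  assumes "pair_digraph D1" "pair_digraph D2" and "x \<in> pverts D1" "y \<in> pverts D2"
  shows "(\<Sum>u \<in> in_neighbors (D1 \<box> D2) (x, y). f u) =
    (\<Sum>u \<in> in_neighbors D1 x. f (u, y)) + (\<Sum>v \<in> in_neighbors D2 y. f (x, v))"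
proof -
  interpret D1: pair_digraph D1 by fact
  interpret D2: pair_digraph D2 by fact
  have "x \<notin> in_neighbors D1 x"
    using D1.pair_no_loops by (fastforce simp: in_neighbors_def)
  then have disjoint: "in_neighbors D1 x \<times> {y} \<inter> {x} \<times> in_neighbors D2 y = {}"
    by auto
  have "finite (in_neighbors D1 x)" "finite (in_neighbors D2 y)"
    by (simp_all add: in_neighbors_def)
  then have "(\<Sum>u \<in> in_neighbors (D1 \<box> D2) (x, y). f u) =
      (\<Sum>u \<in> in_neighbors D1 x \<times> {y}. f u) + (\<Sum>u \<in> {x} \<times> in_neighbors D2 y. f u)"
    unfolding in_neighbors_cart_prod[OF assms(3,4)]
    by (intro sum.union_disjoint disjoint) simp_all
  then show ?thesis
    by (simp add: sum.cartesian_product')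
qed

definition dicycle_walk :: "nat \<Rightarrow> nat \<Rightarrow> nat" where
  "dicycle_walk k i = i mod k + 1"

lemma dicycle_walk_add_self [simp]: "dicycle_walk k (i + k) = dicycle_walk k i"
  by (simp add: dicycle_walk_def)

lemma bij_betw_dicycle_walk: "bij_betw (dicycle_walk k) {..<k} (pverts (dicycle k))"
proof (rule bij_betw_byWitness[where f' = "\<lambda>x. x - 1"])
  show "dicycle_walk k ` {..<k} \<subseteq> pverts (dicycle k)"
    by (auto simp: dicycle_walk_def dicycle_def)
qed (auto simp: dicycle_walk_def dicycle_def)

lemma pverts_dicycle_eq_range_walk:
  assumes "k > 0"
  shows "pverts (dicycle k) = range (dicycle_walk k)"
proof
  show "pverts (dicycle k) \<subseteq> range (dicycle_walk k)"
    using bij_betw_dicycle_walk[of k] by (auto simp: bij_betw_def)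
  show "range (dicycle_walk k) \<subseteq> pverts (dicycle k)"
    using assms by (auto simp: dicycle_walk_def dicycle_def Suc_le_eq)
qed

lemma pverts_dicycle_eq_range_walk_Suc:
  assumes "k > 0"
  shows "pverts (dicycle k) = range (\<lambda>i. dicycle_walk k (Suc i))"
proof -
  have "dicycle_walk k i = dicycle_walk k (Suc (i + k - 1))" for i
    using assms by simp
  then have "range (dicycle_walk k) = range (\<lambda>i. dicycle_walk k (Suc i))"
    by blast
  then show ?thesis
    unfolding pverts_dicycle_eq_range_walk[OF assms] .
qed

lemma in_neighbors_dicycle_walk:
  assumes "k > 0"
  shows "in_neighbors (dicycle k) (dicycle_walk k (Suc i)) = {dicycle_walk k i}"
proof -
  have arc: "(dicycle_walk k j, v) \<in> parcs (dicycle k) \<longleftrightarrow> v = dicycle_walk k (Suc j)" for j v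
    using assms by (auto simp: dicycle_def dicycle_walk_def mod_Suc_eq Suc_le_eq)
  have "dicycle_walk k (Suc i) = dicycle_walk k (Suc j) \<longleftrightarrow> dicycle_walk k i = dicycle_walk k j" for j
    by (auto simp: dicycle_walk_def mod_Suc)
  then show ?thesis
    by (auto simp: in_neighbors_def pverts_dicycle_eq_range_walk[OF assms] arc)
qed

lemma italian_dominating_dicycle_prod_iff:
  assumes "m \<ge> 2" "n \<ge> 2"
  shows "italian_dominating (dicycle m \<box> dicycle n) f \<longleftrightarrow>
    (\<forall>i j. f (dicycle_walk m i, dicycle_walk n j) \<le> 2) \<and>
    (\<forall>i j. f (dicycle_walk m (Suc i), dicycle_walk n (Suc j)) = 0 \<longrightarrow>
      2 \<le> f (dicycle_walk m i, dicycle_walk n (Suc j)) +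
          f (dicycle_walk m (Suc i), dicycle_walk n j))"
    (is "_ \<longleftrightarrow> ?bounded \<and> ?dominated")
proof -
  let ?G = "dicycle m \<box> dicycle n"
  have pos: "m > 0" "n > 0"
    using assms by simp_all
  have "finite (pverts ?G)"
    by (simp add: pverts_cart_prod dicycle_def)
  moreover have "(\<forall>v \<in> pverts ?G. f v \<le> 2) \<longleftrightarrow> ?bounded"
    by (simp add: pverts_cart_prod pverts_dicycle_eq_range_walk pos)
  moreover have "(\<Sum>u \<in> in_neighbors ?G (dicycle_walk m (Suc i), dicycle_walk n (Suc j)). f u) =
      f (dicycle_walk m i, dicycle_walk n (Suc j)) +
      f (dicycle_walk m (Suc i), dicycle_walk n j)" for i j
    using assms pos
    by (simp add: sum_in_neighbors_cart_prod pair_digraph_dicycle in_neighbors_dicycle_walk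
        pverts_dicycle_eq_range_walk)
  then have "(\<forall>v \<in> pverts ?G. f v = 0 \<longrightarrow> 2 \<le> (\<Sum>u \<in> in_neighbors ?G v. f u)) \<longleftrightarrow> ?dominated"
    by (simp add: pverts_cart_prod pverts_dicycle_eq_range_walk_Suc pos)
  ultimately show ?thesis
    by (simp only: italian_dominating_iff_sum)
qed

lemma weight_dicycle_prod:
  "weight (dicycle m \<box> dicycle n) f =
    (\<Sum>i<m. \<Sum>j<n. f (dicycle_walk m i, dicycle_walk n j))"
  unfolding weight_cart_prod
  by (simp flip: sum.reindex_bij_betw[OF bij_betw_dicycle_walk])

lemma sum_lessThan_Suc_cyclic:
  fixes w :: "nat \<Rightarrow> 'a::cancel_comm_monoid_add"
  assumes "w n = w 0"
  shows "(\<Sum>i<n. w (Suc i)) = (\<Sum>i<n. w i)"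
  using sum.lessThan_Suc_shift[of w n] assms by (simp add: add.commute)

lemma cyclic_pair_sums_eq_lower_bound:
  fixes w :: "nat \<Rightarrow> 'a::linordered_semidom"
  assumes "w n = w 0"
    and lower: "\<And>i. i < n \<Longrightarrow> c \<le> w i + w (Suc i)"
    and upper: "2 * (\<Sum>i<n. w i) \<le> of_nat n * c"
    and "i < n"
  shows "w i + w (Suc i) = c"
proof -
  have "(\<Sum>i<n. w i + w (Suc i)) \<le> (\<Sum>i<n. c)"
    using upper by (simp add: sum.distrib sum_lessThan_Suc_cyclic[of w, OF assms(1)] mult_2)
  moreover have "(\<Sum>i<n. c) \<le> (\<Sum>i<n. w i + w (Suc i))"
    using lower by (intro sum_mono) simp
  ultimately have "(\<Sum>i<n. c) = (\<Sum>i<n. w i + w (Suc i))"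
    by (rule antisym[rotated])
  then show ?thesis
    using sum_mono_inv[of "\<lambda>_. c" "{..<n}" "\<lambda>i. w i + w (Suc i)" i] lower \<open>i < n\<close> by simp
qed

lemma odd_cycle_constant_pair_sums_double:
  fixes w :: "nat \<Rightarrow> 'a::cancel_ab_semigroup_add"
  assumes "odd n" "w n = w 0"
    and pair: "\<And>i. i < n \<Longrightarrow> w i + w (Suc i) = c"
    and "i \<le> n"
  shows "w i + w i = c"
proof -
  have alternating: "if even j then w j = w 0 else w j + w 0 = c" if "j \<le> n" for j
    using that
  proof (induction j)
    case (Suc j)
    then have step: "w j + w (Suc j) = c"
      by (intro pair) simp
    show ?case
    proof (cases "even j")
      case True
      then show ?thesis
        using Suc step by (simp add: add.commute)
    next
      case False
      then have "w j + w (Suc j) = w j + w 0"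
        using Suc step by simp
      then show ?thesis
        using False by simp
    qed
  qed simp
  have "w 0 + w 0 = c"
    using alternating[of n] \<open>odd n\<close> \<open>w n = w 0\<close> by simp
  moreover from this have "w i = w 0"
    using alternating[OF \<open>i \<le> n\<close>] by (auto split: if_splits)
  ultimately show ?thesis
    by simp
qed

lemma weight_dicycle_2_prod_odd_ge:
  assumes "odd n" "n \<ge> 2" and f: "italian_dominating (dicycle 2 \<box> dicycle n) f"
  shows "n + 1 \<le> weight (dicycle 2 \<box> dicycle n) f"
proof (rule ccontr)
  assume less: "\<not> n + 1 \<le> weight (dicycle 2 \<box> dicycle n) f"
  define row1 row2 where "row1 j = f (dicycle_walk 2 0, dicycle_walk n j)"
    and "row2 j = f (dicycle_walk 2 1, dicycle_walk n j)" for j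
  define column where "column j = row1 j + row2 j" for j
  have period: "row1 n = row1 0" "column n = column 0"
    using dicycle_walk_add_self[of n 0] by (simp_all add: row1_def row2_def column_def)
  have dominated: "f (dicycle_walk 2 (Suc i), dicycle_walk n (Suc j)) = 0 \<Longrightarrow>
      2 \<le> f (dicycle_walk 2 i, dicycle_walk n (Suc j)) +
          f (dicycle_walk 2 (Suc i), dicycle_walk n j)" for i j
    using f assms(2) by (simp add: italian_dominating_dicycle_prod_iff)
  have row1_dominated: "row1 (Suc j) = 0 \<Longrightarrow> 2 \<le> row2 (Suc j) + row1 j" for j
    using dominated[of 1 j] dicycle_walk_add_self[of 2 0] by (simp add: row1_def row2_def)
  have row2_dominated: "row2 (Suc j) = 0 \<Longrightarrow> 2 \<le> row1 (Suc j) + row2 j" for j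
    using dominated[of 0 j] by (simp add: row1_def row2_def)
  have "(\<Sum>j<n. column j) \<le> n"
    using less by (simp add: weight_dicycle_prod column_def row1_def row2_def sum.distrib numeral_2_eq_2)
  moreover have "2 \<le> column j + column (Suc j)" for j
    using row1_dominated[of j] row2_dominated[of j] unfolding column_def by linarith
  ultimately have "column j + column (Suc j) = 2" if "j < n" for j
    using that period by (intro cyclic_pair_sums_eq_lower_bound[of column n]) simp_all
  then have column_eq_1: "column j = 1" if "j \<le> n" for j
    using odd_cycle_constant_pair_sums_double[of n column 2 j] assms(1) period that by simp
  have "row1 j + row1 (Suc j) = 1" if "j < n" for j
    using row1_dominated[of j] row2_dominated[of j] column_eq_1[of j]
      column_eq_1[of "Suc j"] that
    unfolding column_def by linarith
  then have "row1 0 + row1 0 = 1"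
    using odd_cycle_constant_pair_sums_double[of n row1 1 0] assms(1) period by simp
  then show False
    by presburger
qed

definition checkerboard_full_first_column :: "nat \<times> nat \<Rightarrow> nat" where
  "checkerboard_full_first_column = (\<lambda>(r, j). if j = 1 \<or> even (r + j) then 1 else 0)"

lemma italian_dominating_checkerboard_full_first_column:
  assumes "n \<ge> 2"
  shows "italian_dominating (dicycle 2 \<box> dicycle n) checkerboard_full_first_column"
  using assms
  by (auto simp: italian_dominating_dicycle_prod_iff checkerboard_full_first_column_def
      dicycle_walk_def mod_Suc)

lemma weight_checkerboard_full_first_column:
  assumes "n > 0"
  shows "weight (dicycle 2 \<box> dicycle n) checkerboard_full_first_column = n + 1"
proof -
  let ?f = checkerboard_full_first_column
  have column: "?f (1, Suc j) + ?f (2, Suc j) = (if j = 0 then 2 else 1)" for j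
    by (simp add: checkerboard_full_first_column_def)
  have "weight (dicycle 2 \<box> dicycle n) ?f = (\<Sum>j<n. ?f (1, Suc j) + ?f (2, Suc j))"
    by (simp add: weight_dicycle_prod dicycle_walk_def sum.distrib numeral_2_eq_2)
  also have "\<dots> = (\<Sum>j<n. 1) + (\<Sum>j<n. if j = 0 then 1 else 0)"
    unfolding column sum.distrib[symmetric] by (intro sum.cong) simp_all
  also have "\<dots> = n + 1"
    using assms by simp
  finally show ?thesis .
qed

theorem theorem2p2:
  fixes n :: nat
  assumes "odd n" and "n \<ge> 3"
  shows "\<gamma>\<^sub>I (dicycle 2 \<box> dicycle n) = n + 1"
proof (rule antisym)
  have n: "n > 0" "n \<ge> 2"
    using assms(2) by simp_all
  show "\<gamma>\<^sub>I (dicycle 2 \<box> dicycle n) \<le> n + 1"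
    using italian_domination_number_le[OF italian_dominating_checkerboard_full_first_column[OF n(2)]]
    unfolding weight_checkerboard_full_first_column[OF n(1)] .
  obtain f where "italian_dominating (dicycle 2 \<box> dicycle n) f"
    and "weight (dicycle 2 \<box> dicycle n) f = \<gamma>\<^sub>I (dicycle 2 \<box> dicycle n)"
    using italian_domination_number_attained by blast
  then show "n + 1 \<le> \<gamma>\<^sub>I (dicycle 2 \<box> dicycle n)"
    using weight_dicycle_2_prod_odd_ge[OF assms(1) n(2)] by metis
qed

end
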